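(* Let $b_0,b_1,b_2,\ldots$ be defined by the power series identity $$\sum_{i=0}^{\infty}b_i z^i=\frac{1}{J_0(\sqrt{4z})},\qquad\text{where } J_0(\sqrt{4z})=\sum_{m=0}^{\infty}\frac{(-1)^m}{(m!)^2}z^m,$$ and for integers $s\ge1$, $n\ge0$ put $$\alpha_n^{(s)}=\sum_{i=0}^{s}\frac{(-1)^{s-i}}{(s-i)!}\,b_i\,n^{\underline{s+i}}.$$ Let $\psi_{AL}:\mathbb{C}[x_0,x_1,x_2,\ldots]\to\mathbb{C}[x_0,x_1,x_2,\ldots]$ be the $\mathbb{C}$-algebra homomorphism with $$\psi_{AL}(x_n)=x_n+\sum_{i=1}^{\lfloor (n-1)/2\rfloor}\alpha_n^{(i)}x_{n-2i}\qquad(n\ge0),$$ (an empty sum being $0$). Then $\psi_{AL}$ is an Appel–Lucas intertwining map, i.e. $\psi_{AL}\circ\mathcal{D}_{\mathcal{A}}=\mathcal{D}_{\mathcal{L}}\circ\psi_{AL}$.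
   Context: $n^{\underline{a}}=n(n-1)\cdots(n-a+1)$ is the falling factorial ($n^{\underline 0}=1$). $\mathcal{D}_{\mathcal{A}}$ (Appel) and $\mathcal{D}_{\mathcal{L}}$ (Lucas) are the $\mathbb{C}$-linear derivations of $\mathbb{C}[x_0,x_1,x_2,\ldots]$ determined by $\mathcal{D}_{\mathcal{A}}(x_0)=0$, $\mathcal{D}_{\mathcal{A}}(x_n)=n x_{n-1}$ for $n\ge1$, and $\mathcal{D}_{\mathcal{L}}(x_0)=0$, $\mathcal{D}_{\mathcal{L}}(x_n)=n\sum_{k=0}^{\lfloor (n-1)/2\rfloor}(-1)^k x_{n-1-2k}$ for $n\ge1$. *)

theory Defs
  imports Complex_Main "HOL-Library.Poly_Mapping"
    "HOL-Computational_Algebra.Formal_Power_Series"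
begin

text \<open>
  The ring \<open>\<complex>[x\<^sub>0, x\<^sub>1, x\<^sub>2, \<dots>]\<close> is the monoid algebra over \<open>\<complex>\<close> of the free
  commutative monoid \<open>nat \<Rightarrow>\<^sub>0 nat\<close> of exponent vectors; the library's multiplication on
  \<^typ>\<open>(nat \<Rightarrow>\<^sub>0 nat) \<Rightarrow>\<^sub>0 complex\<close> is convolution.
\<close>

type_synonym cpoly = "(nat \<Rightarrow>\<^sub>0 nat) \<Rightarrow>\<^sub>0 complex"

definition X :: "nat \<Rightarrow> cpoly"
  where "X n = Poly_Mapping.single (Poly_Mapping.single n 1) 1"

definition scale :: "complex \<Rightarrow> cpoly \<Rightarrow> cpoly"
  where "scale c p = Poly_Mapping.single 0 c * p"

definition derivation :: "(cpoly \<Rightarrow> cpoly) \<Rightarrow> bool"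
  where "derivation D \<longleftrightarrow> Vector_Spaces.linear scale scale D \<and>
    (\<forall>p q. D (p * q) = D p * q + p * D q)"

definition algebra_hom :: "(cpoly \<Rightarrow> cpoly) \<Rightarrow> bool"
  where "algebra_hom \<psi> \<longleftrightarrow> Vector_Spaces.linear scale scale \<psi> \<and> \<psi> 1 = 1 \<and>
    (\<forall>p q. \<psi> (p * q) = \<psi> p * \<psi> q)"

definition is_Appel_derivation :: "(cpoly \<Rightarrow> cpoly) \<Rightarrow> bool"
  where "is_Appel_derivation D \<longleftrightarrow> derivation D \<and> D (X 0) = 0 \<and>
    (\<forall>n\<ge>1. D (X n) = scale (of_nat n) (X (n - 1)))"

definition is_Lucas_derivation :: "(cpoly \<Rightarrow> cpoly) \<Rightarrow> bool"
  where "is_Lucas_derivation D \<longleftrightarrow> derivation D \<and> D (X 0) = 0 \<and>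
    (\<forall>n\<ge>1. D (X n) =
      scale (of_nat n) (\<Sum>k = 0..(n - 1) div 2. scale ((- 1) ^ k) (X (n - 1 - 2 * k))))"

definition intertwining_map ::
    "(cpoly \<Rightarrow> cpoly) \<Rightarrow> (cpoly \<Rightarrow> cpoly) \<Rightarrow> (cpoly \<Rightarrow> cpoly) \<Rightarrow> bool"
  where "intertwining_map D E \<psi> \<longleftrightarrow> \<psi> \<circ> D = E \<circ> \<psi>"

text \<open>\<open>J0_sqrt4z\<close> is \<open>J\<^sub>0(\<surd>(4z))\<close> as a formal power series in \<open>z\<close>.\<close>

definition J0_sqrt4z :: "complex fps"
  where "J0_sqrt4z = Abs_fps (\<lambda>m. (- 1) ^ m / (fact m)\<^sup>2)"

definition b_coeff :: "nat \<Rightarrow> complex"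
  where "b_coeff i = fps_nth (1 / J0_sqrt4z) i"

definition falling_fact :: "nat \<Rightarrow> nat \<Rightarrow> complex"
  where "falling_fact n a = (\<Prod>k<a. of_nat n - of_nat k)"

definition alpha :: "nat \<Rightarrow> nat \<Rightarrow> complex"
  where "alpha s n =
    (\<Sum>i = 0..s. (- 1) ^ (s - i) / fact (s - i) * b_coeff i * falling_fact n (s + i))"

text \<open>For \<open>n = 0\<close> the truncated \<open>(n - 1) div 2\<close> is \<open>0\<close> instead of \<open>-1\<close>; the sum is empty
  either way.\<close>

definition is_psi_AL :: "(cpoly \<Rightarrow> cpoly) \<Rightarrow> bool"
  where "is_psi_AL \<psi> \<longleftrightarrow> algebra_hom \<psi> \<and>
    (\<forall>n. \<psi> (X n) = X n + (\<Sum>i = 1..(n - 1) div 2. scale (alpha i n) (X (n - 2 * i))))"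

subsection \<open>The defining conditions determine the three maps\<close>

lemma b_coeff_inverse: "Abs_fps b_coeff * J0_sqrt4z = 1"
proof -
  have "Abs_fps b_coeff = 1 / J0_sqrt4z"
    by (simp add: b_coeff_def fps_eq_iff)
  moreover have "fps_nth J0_sqrt4z 0 \<noteq> 0"
    by (simp add: J0_sqrt4z_def)
  ultimately show ?thesis
    by (simp add: fps_divide_unit inverse_mult_eq_1)
qed

lemma scale_add_right: "scale c (p + q) = scale c p + scale c q"
  and scale_add_left: "scale (c + d) p = scale c p + scale d p"
  and scale_scale: "scale c (scale d p) = scale (c * d) p"
  and scale_one: "scale 1 p = p"
  and scale_zero_left: "scale 0 p = 0"
  and scale_zero_right: "scale c 0 = 0"
  and scale_mult_left: "scale c p * q = scale c (p * q)"
  and scale_mult_right: "p * scale c q = scale c (p * q)"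
  by (simp_all add: scale_def algebra_simps single_add mult_single flip: mult.assoc)

lemma scale_single: "scale c (Poly_Mapping.single m d) = Poly_Mapping.single m (c * d)"
  by (simp add: scale_def mult_single)

lemma scale_sum: "scale c (\<Sum>i\<in>A. f i) = (\<Sum>i\<in>A. scale c (f i))"
  by (simp add: scale_def sum_distrib_left)

lemma vector_space_scale: "vector_space scale"
  by unfold_locales (simp_all add: scale_add_right scale_add_left scale_scale scale_one)

lemma linear_scale_iff: "Vector_Spaces.linear scale scale f \<longleftrightarrow>
    (\<forall>p q. f (p + q) = f p + f q) \<and> (\<forall>c p. f (scale c p) = scale c (f p))"
  using vector_space_scale
  by (auto simp: Vector_Spaces.linear_iff vector_space_def module_hom_iff module_def)

definition monomial :: "(nat \<Rightarrow>\<^sub>0 nat) \<Rightarrow> cpoly"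
  where "monomial m = Poly_Mapping.single m 1"

lemma monomial_0: "monomial 0 = 1" and monomial_add: "monomial (m + n) = monomial m * monomial n"
  by (simp_all add: monomial_def mult_single)

lemma X_monomial: "X n = monomial (Poly_Mapping.single n 1)"
  by (simp add: X_def monomial_def)

lemma poly_expand: "p = (\<Sum>m\<in>Poly_Mapping.keys p. scale (Poly_Mapping.lookup p m) (monomial m))"
  by (rule poly_mapping_eqI)
    (auto simp: monomial_def scale_single lookup_sum lookup_single when_def sum.delta' in_keys_iff)

lemma exponent_induct [case_names zero add]:
  assumes "P 0" and "\<And>m i. P m \<Longrightarrow> P (Poly_Mapping.single i 1 + m)"
  shows "P (m :: nat \<Rightarrow>\<^sub>0 nat)"
proof (induction "\<Sum>i\<in>Poly_Mapping.keys m. Poly_Mapping.lookup m i" arbitrary: m)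
  case 0
  then have "Poly_Mapping.keys m = {}"
    by (fastforce simp: in_keys_iff)
  then have "m = 0" by simp
  with assms(1) show ?case by simp
next
  case (Suc k)
  then obtain i where i: "i \<in> Poly_Mapping.keys m"
    by (metis ex_in_conv sum.empty nat.distinct(1))
  define m' where "m' = m - Poly_Mapping.single i 1"
  have m: "m = Poly_Mapping.single i 1 + m'"
    using i by (intro poly_mapping_eqI)
      (auto simp: m'_def lookup_add lookup_minus lookup_single when_def in_keys_iff)
  have sub: "Poly_Mapping.keys m' \<subseteq> Poly_Mapping.keys m"
    by (auto simp: m lookup_add in_keys_iff)
  have "(\<Sum>j\<in>Poly_Mapping.keys m. Poly_Mapping.lookup m j) =
      (\<Sum>j\<in>Poly_Mapping.keys m. (if j = i then 1 else 0) + Poly_Mapping.lookup m' j)"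
    by (rule sum.cong) (auto simp: m lookup_add lookup_single when_def)
  also have "\<dots> = 1 + (\<Sum>j\<in>Poly_Mapping.keys m. Poly_Mapping.lookup m' j)"
    using i by (simp add: sum.distrib)
  also have "(\<Sum>j\<in>Poly_Mapping.keys m. Poly_Mapping.lookup m' j) =
      (\<Sum>j\<in>Poly_Mapping.keys m'. Poly_Mapping.lookup m' j)"
    using sub by (intro sum.mono_neutral_right) (auto simp: in_keys_iff)
  finally have "k = (\<Sum>j\<in>Poly_Mapping.keys m'. Poly_Mapping.lookup m' j)"
    using Suc(2) by simp
  then have "P m'" by (rule Suc(1))
  then show ?case unfolding m by (rule assms(2))
qed

definition lin_ext :: "((nat \<Rightarrow>\<^sub>0 nat) \<Rightarrow> cpoly) \<Rightarrow> cpoly \<Rightarrow> cpoly"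
  where "lin_ext g p = (\<Sum>m\<in>Poly_Mapping.keys p. scale (Poly_Mapping.lookup p m) (g m))"

lemma lin_ext_superset:
  assumes "finite A" "Poly_Mapping.keys p \<subseteq> A"
  shows "lin_ext g p = (\<Sum>m\<in>A. scale (Poly_Mapping.lookup p m) (g m))"
  unfolding lin_ext_def using assms
  by (intro sum.mono_neutral_left) (auto simp: in_keys_iff scale_zero_left)

lemma lin_ext_add: "lin_ext g (p + q) = lin_ext g p + lin_ext g q"
proof -
  let ?A = "Poly_Mapping.keys p \<union> Poly_Mapping.keys q"
  have "lin_ext g (p + q) = (\<Sum>m\<in>?A. scale (Poly_Mapping.lookup (p + q) m) (g m))"
    by (rule lin_ext_superset) (auto simp: keys_add)
  also have "\<dots> = (\<Sum>m\<in>?A. scale (Poly_Mapping.lookup p m) (g m)) +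
      (\<Sum>m\<in>?A. scale (Poly_Mapping.lookup q m) (g m))"
    by (simp add: lookup_add scale_add_left sum.distrib)
  also have "\<dots> = lin_ext g p + lin_ext g q"
    by (simp flip: lin_ext_superset[of ?A])
  finally show ?thesis .
qed

lemma lin_ext_monomial: "lin_ext g (monomial m) = g m"
  by (simp add: lin_ext_def monomial_def scale_one)

lemma lookup_scale: "Poly_Mapping.lookup (scale c p) m = c * Poly_Mapping.lookup p m"
  by (simp add: scale_def map.rep_eq when_def flip: mult_map_scale_conv_mult)

lemma lin_ext_scale: "lin_ext g (scale c p) = scale c (lin_ext g p)"
proof -
  have "lin_ext g (scale c p) =
      (\<Sum>m\<in>Poly_Mapping.keys p. scale (Poly_Mapping.lookup (scale c p) m) (g m))"
    by (rule lin_ext_superset) (auto simp: in_keys_iff lookup_scale)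
  then show ?thesis
    by (simp add: lookup_scale lin_ext_def scale_sum scale_scale)
qed

lemma linear_lin_ext: "Vector_Spaces.linear scale scale (lin_ext g)"
  by (simp add: linear_scale_iff lin_ext_add lin_ext_scale)

lemma linear_zero: "Vector_Spaces.linear scale scale f \<Longrightarrow> f 0 = 0"
  by (metis linear_scale_iff scale_zero_left)

lemma linear_sum: "Vector_Spaces.linear scale scale f \<Longrightarrow> f (\<Sum>i\<in>A. h i) = (\<Sum>i\<in>A. f (h i))"
  by (induction A rule: infinite_finite_induct) (auto simp: linear_zero linear_scale_iff)

lemma linear_eqI:
  assumes "Vector_Spaces.linear scale scale f" "Vector_Spaces.linear scale scale g"
    and "\<And>m. f (monomial m) = g (monomial m)"
  shows "f = g"
proof
  fix p
  have "f (\<Sum>m\<in>Poly_Mapping.keys p. scale (Poly_Mapping.lookup p m) (monomial m)) =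
      g (\<Sum>m\<in>Poly_Mapping.keys p. scale (Poly_Mapping.lookup p m) (monomial m))"
    unfolding linear_sum[OF assms(1)] linear_sum[OF assms(2)]
    using assms by (simp add: linear_scale_iff)
  then show "f p = g p"
    by (simp flip: poly_expand)
qed

lemma linear_mult_left: "Vector_Spaces.linear scale scale (\<lambda>p. p * q)"
  and linear_mult_right: "Vector_Spaces.linear scale scale (\<lambda>p. q * p)"
  by (simp_all add: linear_scale_iff algebra_simps scale_mult_left scale_mult_right)

lemma bilinear_eqI:
  assumes "\<And>q. Vector_Spaces.linear scale scale (\<lambda>p. F p q)"
    "\<And>p. Vector_Spaces.linear scale scale (F p)"
    "\<And>q. Vector_Spaces.linear scale scale (\<lambda>p. G p q)"
    "\<And>p. Vector_Spaces.linear scale scale (G p)"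
    and "\<And>m n. F (monomial m) (monomial n) = G (monomial m) (monomial n)"
  shows "F p q = G p q"
proof -
  have *: "F (monomial m) = G (monomial m)" for m
    by (rule linear_eqI) (use assms in auto)
  have "(\<lambda>p. F p q) = (\<lambda>p. G p q)"
    by (rule linear_eqI) (use assms * in auto)
  then show ?thesis by metis
qed

lemma ex1_algebra_hom: "\<exists>!\<psi>. algebra_hom \<psi> \<and> (\<forall>n. \<psi> (X n) = v n)"
proof
  define g where "g m = (\<Prod>i\<in>Poly_Mapping.keys m. v i ^ Poly_Mapping.lookup m i)" for m
  have g_sup: "g m = (\<Prod>i\<in>A. v i ^ Poly_Mapping.lookup m i)"
    if "finite A" "Poly_Mapping.keys m \<subseteq> A" for m A
    unfolding g_def using that by (intro prod.mono_neutral_left) (auto simp: in_keys_iff)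
  have g_add: "g (m + n) = g m * g n" for m n
  proof -
    let ?A = "Poly_Mapping.keys m \<union> Poly_Mapping.keys n"
    have "g (m + n) = (\<Prod>i\<in>?A. v i ^ Poly_Mapping.lookup (m + n) i)"
      by (rule g_sup) (auto simp: keys_add)
    also have "\<dots> = (\<Prod>i\<in>?A. v i ^ Poly_Mapping.lookup m i) *
        (\<Prod>i\<in>?A. v i ^ Poly_Mapping.lookup n i)"
      by (simp add: lookup_add power_add prod.distrib)
    also have "\<dots> = g m * g n"
      by (simp flip: g_sup[of ?A])
    finally show ?thesis .
  qed
  have "lin_ext g (p * q) = lin_ext g p * lin_ext g q" for p q
    by (rule bilinear_eqI)
      (simp_all add: linear_scale_iff lin_ext_add lin_ext_scale algebra_simps scale_mult_left
        scale_mult_right lin_ext_monomial g_add flip: monomial_add)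
  moreover have "lin_ext g 1 = 1"
    by (simp add: lin_ext_monomial g_def flip: monomial_0)
  moreover have "lin_ext g (X n) = v n" for n
    by (simp add: X_monomial lin_ext_monomial g_def)
  ultimately show "algebra_hom (lin_ext g) \<and> (\<forall>n. lin_ext g (X n) = v n)"
    by (simp add: algebra_hom_def linear_lin_ext)
  fix \<psi> assume \<psi>: "algebra_hom \<psi> \<and> (\<forall>n. \<psi> (X n) = v n)"
  have "\<psi> (monomial m) = g m" for m
  proof (induction m rule: exponent_induct)
    case zero
    then show ?case using \<psi> by (simp add: monomial_0 algebra_hom_def g_def)
  next
    case (add m i)
    have "g (Poly_Mapping.single i 1) = v i"
      by (simp add: g_def)
    with add show ?case using \<psi>
      by (simp only: monomial_add algebra_hom_def g_add flip: X_monomial)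
  qed
  then show "\<psi> = lin_ext g"
    using \<psi> by (intro linear_eqI) (auto simp: linear_lin_ext algebra_hom_def lin_ext_monomial)
qed

lemma ex1_derivation: "\<exists>!D. derivation D \<and> (\<forall>n. D (X n) = v n)"
proof
  define t where "t m i = scale (of_nat (Poly_Mapping.lookup m i))
    (monomial (m - Poly_Mapping.single i 1) * v i)" for m i
  define g where "g m = (\<Sum>i\<in>Poly_Mapping.keys m. t m i)" for m
  have g_sup: "g m = (\<Sum>i\<in>A. t m i)" if "finite A" "Poly_Mapping.keys m \<subseteq> A" for m A
    unfolding g_def using that
    by (intro sum.mono_neutral_left) (auto simp: t_def in_keys_iff scale_zero_left)
  have half: "scale (of_nat (Poly_Mapping.lookup m i))
      (monomial (m + n - Poly_Mapping.single i 1) * v i) = t m i * monomial n" for m n i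
  proof (cases "Poly_Mapping.lookup m i = 0")
    case False
    then have "m + n - Poly_Mapping.single i 1 = (m - Poly_Mapping.single i 1) + n"
      by (intro poly_mapping_eqI) (auto simp: lookup_add lookup_minus lookup_single when_def)
    then show ?thesis
      by (simp only: t_def monomial_add scale_mult_left) (simp only: mult_ac)
  qed (simp add: t_def scale_zero_left)
  have t_add: "t (m + n) i = t m i * monomial n + monomial m * t n i" for m n i
    using half[of m i n] half[of n i m]
    by (simp add: t_def[of "m + n"] lookup_add scale_add_left add.commute[of n m] mult.commute)
  have g_add: "g (m + n) = g m * monomial n + monomial m * g n" for m n
  proof -
    let ?A = "Poly_Mapping.keys m \<union> Poly_Mapping.keys n"
    have "g (m + n) = (\<Sum>i\<in>?A. t (m + n) i)"
      by (rule g_sup) (auto simp: keys_add)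
    also have "\<dots> = (\<Sum>i\<in>?A. t m i) * monomial n + monomial m * (\<Sum>i\<in>?A. t n i)"
      by (simp add: t_add sum.distrib sum_distrib_left sum_distrib_right)
    also have "\<dots> = g m * monomial n + monomial m * g n"
      by (simp flip: g_sup[of ?A])
    finally show ?thesis .
  qed
  have "lin_ext g (p * q) = lin_ext g p * q + p * lin_ext g q" for p q
    by (rule bilinear_eqI)
      (simp_all add: linear_scale_iff lin_ext_add lin_ext_scale algebra_simps scale_mult_left
        scale_mult_right scale_add_right lin_ext_monomial g_add flip: monomial_add)
  moreover have "lin_ext g (X n) = v n" for n
    by (simp add: X_monomial lin_ext_monomial g_def t_def monomial_0 scale_one)
  ultimately show "derivation (lin_ext g) \<and> (\<forall>n. lin_ext g (X n) = v n)"
    by (simp add: derivation_def linear_lin_ext)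
  fix D assume D: "derivation D \<and> (\<forall>n. D (X n) = v n)"
  have D1: "D 1 = 0"
    using D by (metis derivation_def mult_1 mult_1_right add_cancel_right_right)
  have "D (monomial m) = g m" for m
  proof (induction m rule: exponent_induct)
    case zero
    then show ?case using D1 by (simp add: monomial_0 g_def)
  next
    case (add m i)
    have "g (Poly_Mapping.single i 1) = v i"
      by (simp add: g_def t_def monomial_0 scale_one)
    with add show ?case using D
      by (simp only: monomial_add derivation_def g_add flip: X_monomial)
  qed
  then show "D = lin_ext g"
    using D by (intro linear_eqI) (auto simp: linear_lin_ext derivation_def lin_ext_monomial)
qed

lemma ex1_Appel_derivation: "\<exists>!D. is_Appel_derivation D"
proof -
  let ?v = "\<lambda>n. if n = 0 then 0 else scale (of_nat n) (X (n - 1))"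
  have "is_Appel_derivation D \<longleftrightarrow> derivation D \<and> (\<forall>n. D (X n) = ?v n)" for D
    by (auto simp: is_Appel_derivation_def Suc_le_eq)
  then show ?thesis
    using ex1_derivation[of ?v] by simp
qed

lemma ex1_Lucas_derivation: "\<exists>!D. is_Lucas_derivation D"
proof -
  let ?v = "\<lambda>n. if n = 0 then 0 else
    scale (of_nat n) (\<Sum>k = 0..(n - 1) div 2. scale ((- 1) ^ k) (X (n - 1 - 2 * k)))"
  have "is_Lucas_derivation D \<longleftrightarrow> derivation D \<and> (\<forall>n. D (X n) = ?v n)" for D
    by (auto simp: is_Lucas_derivation_def Suc_le_eq)
  then show ?thesis
    using ex1_derivation[of ?v] by simp
qed

lemma ex1_psi_AL: "\<exists>!\<psi>. is_psi_AL \<psi>"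
  unfolding is_psi_AL_def by (rule ex1_algebra_hom)

end

theory Submission
  imports Defs
begin

text \<open>
  Both \<open>\<psi> \<circ> D\<close> and \<open>E \<circ> \<psi>\<close> obey a Leibniz rule twisted by \<open>\<psi>\<close>, so they coincide as soon as
  they agree on the variables (\<open>intertwining_mapI\<close>). On \<open>x\<^sub>0\<close> both sides vanish. On
  \<open>x\<^bsub>m+1\<^esub>\<close> one compares the coefficients of \<open>x\<^bsub>m-2s\<^esub>\<close>, which leads to
  \<open>\<Sum>i\<le>s. (-1)\<^bsup>s-i\<^esup> (m+1-2i) \<alpha>\<^sub>i(m+1) = (m+1) \<alpha>\<^sub>s(m)\<close>.
  Adding the instances for \<open>s\<close> and \<open>s + 1\<close> telescopes the alternating sum, so this amounts to the
  recurrence \<open>(m+1-2(s+1)) \<alpha>\<^bsub>s+1\<^esub>(m+1) = (m+1) (\<alpha>\<^bsub>s+1\<^esub>(m) + \<alpha>\<^sub>s(m))\<close>. The recurrence holds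
  for arbitrary numbers \<open>b\<^sub>i\<close>, by comparing the coefficients of \<open>b\<^sub>i\<close>.

  Apart from \<open>b\<^sub>0 = 1\<close>, which makes \<open>\<alpha>\<^sub>0 = 1\<close> the leading coefficient of \<open>\<psi>(x\<^sub>n)\<close>, the Bessel
  series enters only at the boundary. For even \<open>m = 2s > 0\<close> the Lucas side contains
  \<open>x\<^sub>0\<close>, with coefficient \<open>(m+1) \<alpha>\<^sub>s(2s)\<close>, whereas \<open>\<psi>(x\<^sub>m)\<close> has no such term. But
  \<open>\<alpha>\<^sub>s(2s) / (2s)!\<close> is the coefficient of \<open>z\<^sup>s\<close> in \<open>(1/J\<^sub>0(\<surd>(4z))) J\<^sub>0(\<surd>(4z)) = 1\<close>, hence zero.
\<close>

section \<open>The numbers \<open>\<alpha>\<close>\<close>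

lemma falling_fact_Suc_right: "falling_fact n (Suc a) = falling_fact n a * (of_nat n - of_nat a)"
  by (simp add: falling_fact_def)

lemma falling_fact_Suc_Suc: "falling_fact (Suc n) (Suc a) = of_nat (Suc n) * falling_fact n a"
  unfolding falling_fact_def prod.lessThan_Suc_shift by simp

lemma falling_fact_eq_fact_quotient:
  assumes "a \<le> n"
  shows "falling_fact n a = fact n / fact (n - a)"
  using assms
proof (induction a arbitrary: n)
  case (Suc a)
  then obtain m where "n = Suc m" "a \<le> m"
    by (cases n) auto
  then show ?case
    using Suc.IH[of m] by (simp add: falling_fact_Suc_Suc)
qed (simp add: falling_fact_def)

lemma alpha_0: "alpha 0 n = 1"
  by (simp add: alpha_def falling_fact_def b_coeff_def J0_sqrt4z_def fps_divide_unit)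

text \<open>
  At \<open>n = 2s\<close> the falling factorial of length \<open>s + i\<close> is \<open>(2s)! / (s-i)!\<close>, which supplies the
  second factor \<open>(s-i)!\<close> in the coefficients of \<open>J\<^sub>0(\<surd>(4z))\<close>. The sum becomes a Cauchy product.
\<close>
lemma alpha_middle_eq_0:
  assumes "s \<ge> 1"
  shows "alpha s (2 * s) = 0"
proof -
  have "alpha s (2 * s) =
      fact (2 * s) * (\<Sum>i = 0..s. b_coeff i * ((- 1) ^ (s - i) / (fact (s - i))\<^sup>2))"
    unfolding alpha_def sum_distrib_left
  proof (rule sum.cong)
    fix i assume i: "i \<in> {0..s}"
    then have "falling_fact (2 * s) (s + i) = fact (2 * s) / fact (s - i)"
      by (subst falling_fact_eq_fact_quotient) auto
    then show "(- 1) ^ (s - i) / fact (s - i) * b_coeff i * falling_fact (2 * s) (s + i) =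
        fact (2 * s) * (b_coeff i * ((- 1) ^ (s - i) / (fact (s - i))\<^sup>2))"
      by (simp add: power2_eq_square)
  qed simp
  also have "(\<Sum>i = 0..s. b_coeff i * ((- 1) ^ (s - i) / (fact (s - i))\<^sup>2)) =
      fps_nth (Abs_fps b_coeff * J0_sqrt4z) s"
    by (simp add: fps_mult_nth J0_sqrt4z_def)
  also have "\<dots> = 0"
    using assms by (simp add: b_coeff_inverse)
  finally show ?thesis by simp
qed

text \<open>
  Put \<open>c = (-1)\<^bsup>s+1-i\<^esup> / (s+1-i)!\<close> and \<open>f\<close> for the falling factorial of \<open>n + 1\<close> of length
  \<open>s + 1 + i\<close>. The factor \<open>n + 1\<close> turns the falling factorials of \<open>n\<close> on the right into
  \<open>f (n-s-i)\<close> and \<open>f\<close>, so the coefficient of \<open>b\<^sub>i\<close> there is \<open>c f ((n-s-i) - (s+1-i))\<close>, and the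
  bracket is \<open>n + 1 - 2(s + 1)\<close>.
\<close>
lemma alpha_recurrence:
  "(of_nat (Suc n) - 2 * of_nat (Suc s)) * alpha (Suc s) (Suc n) =
    of_nat (Suc n) * (alpha (Suc s) n + alpha s n)"
proof -
  define c :: "nat \<Rightarrow> complex" where "c i = (- 1) ^ (Suc s - i) / fact (Suc s - i)" for i
  define f where "f i = falling_fact (Suc n) (Suc s + i)" for i
  have f_Suc: "of_nat (Suc n) * falling_fact n (Suc s + i) = f i * (of_nat n - of_nat s - of_nat i)"
    for i
    unfolding f_def falling_fact_Suc_Suc[symmetric] falling_fact_Suc_right by simp
  have f: "of_nat (Suc n) * falling_fact n (s + i) = f i" for i
    by (simp add: f_def falling_fact_Suc_Suc)
  have c: "(- 1) ^ (s - i) / fact (s - i) = - (of_nat (Suc s - i) * c i)" if "i \<le> s" for i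
    using that by (simp add: c_def Suc_diff_le divide_simps del: of_nat_Suc)
  have "of_nat (Suc n) * alpha s n =
      (\<Sum>i = 0..s. (- 1) ^ (s - i) / fact (s - i) * b_coeff i *
        (of_nat (Suc n) * falling_fact n (s + i)))"
    by (simp add: alpha_def sum_distrib_left mult_ac)
  also have "\<dots> = (\<Sum>i = 0..s. - (of_nat (Suc s - i) * c i) * b_coeff i * f i)"
    unfolding f by (intro sum.cong refl) (simp only: c atLeastAtMost_iff)
  \<comment> \<open>The term \<open>i = s + 1\<close> has factor \<open>0\<close>, so both \<open>\<alpha>\<close> on the right get the same range.\<close>
  also have "\<dots> = (\<Sum>i = 0..Suc s. - (of_nat (Suc s - i) * c i) * b_coeff i * f i)"
    by simp
  finally have lower: "of_nat (Suc n) * alpha s n = \<dots>" .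
  have "of_nat (Suc n) * alpha (Suc s) n =
      (\<Sum>i = 0..Suc s. c i * b_coeff i * (of_nat (Suc n) * falling_fact n (Suc s + i)))"
    by (simp only: alpha_def sum_distrib_left c_def mult_ac)
  also have "\<dots> = (\<Sum>i = 0..Suc s. c i * b_coeff i * (f i * (of_nat n - of_nat s - of_nat i)))"
    unfolding f_Suc ..
  finally have upper: "of_nat (Suc n) * alpha (Suc s) n = \<dots>" .
  have "of_nat (Suc n) * (alpha (Suc s) n + alpha s n) =
      (\<Sum>i = 0..Suc s. c i * b_coeff i * (f i * (of_nat n - of_nat s - of_nat i)) +
        - (of_nat (Suc s - i) * c i) * b_coeff i * f i)"
    by (simp only: distrib_left lower upper sum.distrib)
  also have "\<dots> = (\<Sum>i = 0..Suc s. (of_nat (Suc n) - 2 * of_nat (Suc s)) * (c i * b_coeff i * f i))"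
    by (intro sum.cong refl) (simp add: of_nat_diff algebra_simps)
  also have "\<dots> = (of_nat (Suc n) - 2 * of_nat (Suc s)) * alpha (Suc s) (Suc n)"
    by (simp only: alpha_def sum_distrib_left c_def f_def)
  finally show ?thesis by simp
qed

lemma alpha_alternating_sum:
  "(\<Sum>i\<le>s. (- 1) ^ (s - i) * ((of_nat (Suc m) - 2 * of_nat i) * alpha i (Suc m))) =
    of_nat (Suc m) * alpha s m"
proof (induction s)
  case (Suc s)
  let ?t = "\<lambda>i. (of_nat (Suc m) - 2 * of_nat i) * alpha i (Suc m)"
  have "(\<Sum>i\<le>Suc s. (- 1) ^ (Suc s - i) * ?t i) =
      ?t (Suc s) + (\<Sum>i\<le>s. (- 1) ^ (Suc s - i) * ?t i)"
    by simp
  also have "(\<Sum>i\<le>s. (- 1) ^ (Suc s - i) * ?t i) = - (\<Sum>i\<le>s. (- 1) ^ (s - i) * ?t i)"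
    unfolding sum_negf[symmetric] by (intro sum.cong) (simp_all add: Suc_diff_le)
  also have "?t (Suc s) + \<dots> = of_nat (Suc m) * alpha (Suc s) m"
    unfolding Suc.IH alpha_recurrence by (simp add: algebra_simps)
  finally show ?case .
qed (simp add: alpha_0)

section \<open>Comparison on the variables\<close>

lemma scale_sum_left: "scale (\<Sum>i\<in>A. c i) p = (\<Sum>i\<in>A. scale (c i) p)"
  by (induction A rule: infinite_finite_induct) (simp_all add: scale_zero_left scale_add_left)

lemma derivation_one:
  assumes "derivation D"
  shows "D 1 = 0"
  using assms by (metis derivation_def mult_1 mult_1_right add_cancel_right_right)

lemma intertwining_mapI:
  assumes D: "derivation D" and E: "derivation E" and \<psi>: "algebra_hom \<psi>"
    and X: "\<And>n. \<psi> (D (X n)) = E (\<psi> (X n))"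
  shows "intertwining_map D E \<psi>"
  unfolding intertwining_map_def
proof (rule linear_eqI)
  show "Vector_Spaces.linear scale scale (\<psi> \<circ> D)" "Vector_Spaces.linear scale scale (E \<circ> \<psi>)"
    using D E \<psi> by (simp_all add: derivation_def algebra_hom_def linear_scale_iff)
  fix m
  show "(\<psi> \<circ> D) (monomial m) = (E \<circ> \<psi>) (monomial m)"
  proof (induction m rule: exponent_induct)
    case zero
    have "\<psi> 0 = 0"
      using \<psi> by (simp add: algebra_hom_def linear_zero)
    then show ?case
      using \<psi> by (simp add: monomial_0 derivation_one[OF D] derivation_one[OF E] algebra_hom_def)
  next
    case (add m i)
    have "\<psi> (D (X i * monomial m)) = E (\<psi> (X i * monomial m))"
      using D E \<psi> X[of i] add by (simp add: derivation_def algebra_hom_def linear_scale_iff)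
    then show ?case
      by (simp only: comp_apply monomial_add X_monomial)
  qed
qed

text \<open>
  In both forms the term \<open>i = 0\<close> is the leading \<open>x\<^sub>n\<close>. The second form, with one more term when
  \<open>n > 0\<close> is even, is the one whose range matches that of \<open>D_L (\<psi> (x\<^bsub>n+1\<^esub>))\<close>.
\<close>
lemma psi_AL_X:
  assumes "is_psi_AL \<psi>"
  shows "\<psi> (X n) = (\<Sum>i\<le>(n - 1) div 2. scale (alpha i n) (X (n - 2 * i)))"
    and "\<psi> (X n) = (\<Sum>i\<le>n div 2. scale (alpha i n) (X (n - 2 * i)))"
proof -
  have "\<psi> (X n) = X n + (\<Sum>i = 1..(n - 1) div 2. scale (alpha i n) (X (n - 2 * i)))"
    using assms by (simp add: is_psi_AL_def)
  also have "\<dots> = (\<Sum>i\<le>(n - 1) div 2. scale (alpha i n) (X (n - 2 * i)))"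
    by (simp add: atMost_atLeast0 sum.atLeast_Suc_atMost alpha_0 scale_one)
  finally show short: "\<psi> (X n) = \<dots>" .
  have "(\<Sum>i\<le>(n - 1) div 2. scale (alpha i n) (X (n - 2 * i))) =
      (\<Sum>i\<le>n div 2. scale (alpha i n) (X (n - 2 * i)))"
  proof (rule sum.mono_neutral_left)
    show "\<forall>i\<in>{..n div 2} - {..(n - 1) div 2}. scale (alpha i n) (X (n - 2 * i)) = 0"
    proof
      fix i assume "i \<in> {..n div 2} - {..(n - 1) div 2}"
      then have "n = 2 * i" "i \<ge> 1"
        by (simp_all, presburger+)
      then show "scale (alpha i n) (X (n - 2 * i)) = 0"
        by (simp add: alpha_middle_eq_0 scale_zero_left)
    qed
  qed (auto intro: order_trans div_le_mono)
  with short show "\<psi> (X n) = (\<Sum>i\<le>n div 2. scale (alpha i n) (X (n - 2 * i)))"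
    by simp
qed

lemma Lucas_derivation_psi_AL_X_Suc:
  assumes L: "is_Lucas_derivation D" and \<psi>: "is_psi_AL \<psi>"
  shows "D (\<psi> (X (Suc m))) = scale (of_nat (Suc m)) (\<psi> (X m))"
proof -
  define M where "M = m div 2"
  define t :: "nat \<Rightarrow> complex"
    where "t i = (of_nat (Suc m) - 2 * of_nat i) * alpha i (Suc m)" for i
  have lin: "Vector_Spaces.linear scale scale D"
    using L by (simp add: is_Lucas_derivation_def derivation_def)
  have D_term: "D (scale (alpha i (Suc m)) (X (Suc m - 2 * i))) =
      (\<Sum>k\<le>M - i. scale ((- 1) ^ k * t i) (X (m - 2 * (i + k))))" if "i \<le> M" for i
  proof -
    have i: "2 * i \<le> m"
      using that by (simp add: M_def)
    then have idx: "Suc m - 2 * i - 1 = m - 2 * i" "(m - 2 * i) div 2 = M - i"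
      by (simp_all add: M_def)
    have "D (scale (alpha i (Suc m)) (X (Suc m - 2 * i))) =
        scale (alpha i (Suc m)) (D (X (Suc m - 2 * i)))"
      using lin by (simp add: linear_scale_iff)
    also have "D (X (Suc m - 2 * i)) = scale (of_nat (Suc m - 2 * i))
        (\<Sum>k\<le>M - i. scale ((- 1) ^ k) (X (m - 2 * i - 2 * k)))"
      using L i unfolding is_Lucas_derivation_def atMost_atLeast0 idx[symmetric] by simp
    also have "scale (alpha i (Suc m)) \<dots> =
        (\<Sum>k\<le>M - i. scale ((- 1) ^ k * t i) (X (m - 2 * (i + k))))"
      unfolding scale_sum scale_scale t_def using i
      by (intro sum.cong refl arg_cong2[where f = scale] arg_cong[where f = X])
        (simp_all add: of_nat_diff algebra_simps)
    finally show ?thesis .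
  qed
  have "D (\<psi> (X (Suc m))) =
      (\<Sum>i\<le>M. \<Sum>k\<le>M - i. scale ((- 1) ^ k * t i) (X (m - 2 * (i + k))))"
    unfolding psi_AL_X(1)[OF \<psi>] linear_sum[OF lin] by (simp add: D_term flip: M_def)
  also have "\<dots> = (\<Sum>(i, k)\<in>{(i, k). i + k \<le> M}. scale ((- 1) ^ k * t i) (X (m - 2 * (i + k))))"
    unfolding sum.Sigma[OF finite_atMost ballI[OF finite_atMost]]
    by (rule sum.cong) auto
  also have "\<dots> = (\<Sum>s\<le>M. \<Sum>i\<le>s. scale ((- 1) ^ (s - i) * t i) (X (m - 2 * s)))"
    unfolding sum.triangle_reindex_eq by (intro sum.cong refl) simp
  also have "\<dots> = (\<Sum>s\<le>M. scale (of_nat (Suc m) * alpha s m) (X (m - 2 * s)))"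
    unfolding scale_sum_left[symmetric] t_def alpha_alternating_sum ..
  also have "\<dots> = scale (of_nat (Suc m)) (\<psi> (X m))"
    unfolding psi_AL_X(2)[OF \<psi>] scale_sum scale_scale M_def ..
  finally show ?thesis .
qed

section \<open>The Appel--Lucas intertwining map\<close>

theorem theorem3p1:
  fixes D_A D_L \<psi>_AL :: "cpoly \<Rightarrow> cpoly"
  assumes "is_Appel_derivation D_A"
    and "is_Lucas_derivation D_L"
    and "is_psi_AL \<psi>_AL"
  shows "intertwining_map D_A D_L \<psi>_AL"
proof (rule intertwining_mapI)
  show hom: "algebra_hom \<psi>_AL"
    using assms(3) by (simp add: is_psi_AL_def)
  show "derivation D_A" "derivation D_L"
    using assms(1,2) by (simp_all add: is_Appel_derivation_def is_Lucas_derivation_def)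
  fix n
  show "\<psi>_AL (D_A (X n)) = D_L (\<psi>_AL (X n))"
  proof (cases n)
    case 0
    then show ?thesis
      using assms hom
      by (simp add: is_Appel_derivation_def is_Lucas_derivation_def is_psi_AL_def
          algebra_hom_def linear_zero)
  next
    case (Suc m)
    have "\<psi>_AL (D_A (X (Suc m))) = scale (of_nat (Suc m)) (\<psi>_AL (X m))"
      using assms(1) hom
      by (simp add: is_Appel_derivation_def algebra_hom_def linear_scale_iff del: of_nat_Suc)
    then show ?thesis
      by (simp only: Suc Lucas_derivation_psi_AL_X_Suc[OF assms(2,3)])
  qed
qed

end
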